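(* Let $G=(G^0,G^1,\mathrm{s},\mathrm{t})$ be a directed graph, and let $p:G^0\sqcup G^1\to\mathbb{N}$ be a function such that (1) $p(e)\le p(\mathrm{s}(e))$ for all $e\in G^1$, and (2) if $v\in G^0$ is a source then $p(v)=0$. Let $G_{\mathrm{os},p}$ be the out-splitting of $G$ determined by $p$. For each category $\mathsf{C}$ there is an equivalence of categories $$\mathsf{Diag}^{\sqcup}_{\mathsf{C}}(G)\cong \mathsf{Diag}^{\sqcup}_{\mathsf{C}}(G_{\mathrm{os},p}).$$
   Context: A directed graph $G=(G^0,G^1,\mathrm{s},\mathrm{t})$ consists of a nonempty set $G^0$ of vertices, a set $G^1$ of edges, and source and target maps $\mathrm{s},\mathrm{t}:G^1\to G^0$ (no finiteness is assumed). A vertex $v$ is a source if $\mathrm{t}^{-1}(v)=\emptyset$. Here $\mathbb{N}=\{0,1,2,\dots\}$. The out-splitting $G_{\mathrm{os},p}=(G_{\mathrm{os},p}^0,G_{\mathrm{os},p}^1,\mathrm{s}_{\mathrm{os},p},\mathrm{t}_{\mathrm{os},p})$ is the directed graph with $G_{\mathrm{os},p}^0=\{(v,n)\mid v\in G^0,\ 0\le n\le p(v)\}$, $G_{\mathrm{os},p}^1=\{(e,n)\mid e\in G^1,\ 0\le n\le p(\mathrm{t}(e))\}$, $\mathrm{s}_{\mathrm{os},p}(e,n)=(\mathrm{s}(e),p(e))$, $\mathrm{t}_{\mathrm{os},p}(e,n)=(\mathrm{t}(e),n)$ (with $n\in\mathbb{N}$). For a category $\mathsf{C}$, a diagram $D$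 in $\mathsf{C}$ of shape $G$ consists of an object $D_v$ of $\mathsf{C}$ for each $v\in G^0$ and a morphism $D_e:D_{\mathrm{s}(e)}\to D_{\mathrm{t}(e)}$ for each $e\in G^1$. A morphism $T:D\to E$ consists of morphisms $T_v:D_v\to E_v$ ($v\in G^0$) with $T_{\mathrm{t}(e)}\circ D_e=E_e\circ T_{\mathrm{s}(e)}$ for all $e\in G^1$. The diagram $D$ satisfies the coproduct condition if for every vertex $v$ that is not a source, the family of morphisms $(D_e:D_{\mathrm{s}(e)}\to D_v\mid e\in \mathrm{t}^{-1}(v))$ makes $D_v$ a coproduct in $\mathsf{C}$ of the family $(D_{\mathrm{s}(e)}\mid e\in \mathrm{t}^{-1}(v))$ (this includes the requirement that such a coproduct exists). $\mathsf{Diag}^{\sqcup}_{\mathsf{C}}(G)$ is the category of diagrams in $\mathsf{C}$ of shape $G$ satisfying the coproduct condition, with all morphisms of diagrams between them. *)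

theory Defs
  imports "Graph_Theory.Digraph" "HOL-Library.FuncSet"
begin

section \<open>Categories, functors and equivalences\<close>

text \<open>
  Objects and arrows range over carrier sets, and every arrow determines its domain and codomain.
  The values of the operations outside the carriers, and of \<open>Comp C g f\<close> when
  \<open>Dom C g \<noteq> Cod C f\<close>, are irrelevant.
\<close>

record ('o, 'm) category =
  Obj :: "'o set"
  Arr :: "'m set"
  Dom :: "'m \<Rightarrow> 'o"
  Cod :: "'m \<Rightarrow> 'o"
  Ident :: "'o \<Rightarrow> 'm"
  Comp :: "'m \<Rightarrow> 'm \<Rightarrow> 'm"  (infixl "\<cdot>\<index>" 70)

definition Hom :: "('o, 'm) category \<Rightarrow> 'o \<Rightarrow> 'o \<Rightarrow> 'm set" where
  "Hom C a b = {f \<in> Arr C. Dom C f = a \<and> Cod C f = b}"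

locale category =
  fixes C :: "('o, 'm) category" (structure)
  assumes Dom_in_Obj: "f \<in> Arr C \<Longrightarrow> Dom C f \<in> Obj C"
    and Cod_in_Obj: "f \<in> Arr C \<Longrightarrow> Cod C f \<in> Obj C"
    and Ident_in_Hom: "a \<in> Obj C \<Longrightarrow> Ident C a \<in> Hom C a a"
    and Comp_in_Hom: "\<lbrakk>f \<in> Hom C a b; g \<in> Hom C b c\<rbrakk> \<Longrightarrow> g \<cdot> f \<in> Hom C a c"
    and Comp_Ident_left: "f \<in> Hom C a b \<Longrightarrow> Ident C b \<cdot> f = f"
    and Comp_Ident_right: "f \<in> Hom C a b \<Longrightarrow> f \<cdot> Ident C a = f"
    and Comp_assoc: "\<lbrakk>f \<in> Hom C a b; g \<in> Hom C b c; h \<in> Hom C c d\<rbrakk>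
      \<Longrightarrow> (h \<cdot> g) \<cdot> f = h \<cdot> (g \<cdot> f)"

definition isomorphism :: "('o, 'm) category \<Rightarrow> 'm \<Rightarrow> bool" where
  "isomorphism C f \<longleftrightarrow> f \<in> Arr C \<and>
    (\<exists>g \<in> Hom C (Cod C f) (Dom C f).
      g \<cdot>\<^bsub>C\<^esub> f = Ident C (Dom C f) \<and> f \<cdot>\<^bsub>C\<^esub> g = Ident C (Cod C f))"

record ('o1, 'm1, 'o2, 'm2) functor_maps =
  ObjMap :: "'o1 \<Rightarrow> 'o2"
  ArrMap :: "'m1 \<Rightarrow> 'm2"

locale cat_functor = A: category A + B: category B
  for A :: "('o1, 'm1) category" and B :: "('o2, 'm2) category" +
  fixes F :: "('o1, 'm1, 'o2, 'm2) functor_maps"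
  assumes ObjMap_in_Obj: "a \<in> Obj A \<Longrightarrow> ObjMap F a \<in> Obj B"
    and ArrMap_in_Hom: "f \<in> Hom A a b \<Longrightarrow> ArrMap F f \<in> Hom B (ObjMap F a) (ObjMap F b)"
    and ArrMap_Ident: "a \<in> Obj A \<Longrightarrow> ArrMap F (Ident A a) = Ident B (ObjMap F a)"
    and ArrMap_Comp: "\<lbrakk>f \<in> Hom A a b; g \<in> Hom A b c\<rbrakk>
      \<Longrightarrow> ArrMap F (g \<cdot>\<^bsub>A\<^esub> f) = ArrMap F g \<cdot>\<^bsub>B\<^esub> ArrMap F f"

definition id_functor :: "('o, 'm, 'o, 'm) functor_maps" where
  "id_functor = \<lparr>ObjMap = (\<lambda>a. a), ArrMap = (\<lambda>f. f)\<rparr>"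

definition comp_functor ::
  "('o2, 'm2, 'o3, 'm3) functor_maps \<Rightarrow> ('o1, 'm1, 'o2, 'm2) functor_maps
    \<Rightarrow> ('o1, 'm1, 'o3, 'm3) functor_maps" where
  "comp_functor G F = \<lparr>ObjMap = ObjMap G \<circ> ObjMap F, ArrMap = ArrMap G \<circ> ArrMap F\<rparr>"

locale natural_isomorphism = F: cat_functor A B F + G: cat_functor A B G
  for A :: "('o1, 'm1) category" and B :: "('o2, 'm2) category" and F G +
  fixes \<tau> :: "'o1 \<Rightarrow> 'm2"
  assumes component_in_Hom: "a \<in> Obj A \<Longrightarrow> \<tau> a \<in> Hom B (ObjMap F a) (ObjMap G a)"
    and component_iso: "a \<in> Obj A \<Longrightarrow> isomorphism B (\<tau> a)"
    and natural: "f \<in> Hom A a b \<Longrightarrow> \<tau> b \<cdot>\<^bsub>B\<^esub> ArrMap F f = ArrMap G f \<cdot>\<^bsub>B\<^esub> \<tau> a"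

definition equivalent_categories ::
  "('o1, 'm1) category \<Rightarrow> ('o2, 'm2) category \<Rightarrow> bool" where
  "equivalent_categories A B \<longleftrightarrow>
    (\<exists>F G. cat_functor A B F \<and> cat_functor B A G \<and>
      (\<exists>\<eta>. natural_isomorphism A A id_functor (comp_functor G F) \<eta>) \<and>
      (\<exists>\<epsilon>. natural_isomorphism B B (comp_functor F G) id_functor \<epsilon>))"

definition is_coproduct ::
  "('o, 'm) category \<Rightarrow> 'i set \<Rightarrow> ('i \<Rightarrow> 'o) \<Rightarrow> 'o \<Rightarrow> ('i \<Rightarrow> 'm) \<Rightarrow> bool" where
  "is_coproduct C I X P \<iota> \<longleftrightarrow>
    P \<in> Obj C \<and> (\<forall>i \<in> I. X i \<in> Obj C \<and> \<iota> i \<in> Hom C (X i) P) \<and>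
    (\<forall>Y \<in> Obj C. \<forall>f. (\<forall>i \<in> I. f i \<in> Hom C (X i) Y) \<longrightarrow>
      (\<exists>!h. h \<in> Hom C P Y \<and> (\<forall>i \<in> I. h \<cdot>\<^bsub>C\<^esub> \<iota> i = f i)))"


section \<open>Directed graphs and out-splittings\<close>

text \<open>
  In the Graph Theory library the source map of a digraph is \<^const>\<open>tail\<close> and the target map
  is \<^const>\<open>head\<close>; hence \<^term>\<open>in_arcs G v\<close> is the preimage of \<open>v\<close> under the target map.
\<close>

definition source_vertex :: "('v, 'e) pre_digraph \<Rightarrow> 'v \<Rightarrow> bool" where
  "source_vertex G v \<longleftrightarrow> v \<in> verts G \<and> in_arcs G v = {}"

definition out_splitting ::
  "('v, 'e) pre_digraph \<Rightarrow> ('v + 'e \<Rightarrow> nat) \<Rightarrow> ('v \<times> nat, 'e \<times> nat) pre_digraph" where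
  "out_splitting G p =
    \<lparr>verts = {(v, n). v \<in> verts G \<and> n \<le> p (Inl v)},
     arcs = {(e, n). e \<in> arcs G \<and> n \<le> p (Inl (head G e))},
     tail = (\<lambda>(e, n). (tail G e, p (Inr e))),
     head = (\<lambda>(e, n). (head G e, n))\<rparr>"


section \<open>Diagrams of the shape of a directed graph\<close>

record ('v, 'e, 'o, 'm) diagram =
  at_vert :: "'v \<Rightarrow> 'o"
  at_arc :: "'e \<Rightarrow> 'm"

text \<open>
  The families are extensional, so that equality of diagrams, and of morphisms of diagrams, is
  equality of their components at the vertices and edges of the graph.
\<close>

definition diagrams ::
  "('o, 'm) category \<Rightarrow> ('v, 'e) pre_digraph \<Rightarrow> ('v, 'e, 'o, 'm) diagram set" where
  "diagrams C G = {D.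
    at_vert D \<in> verts G \<rightarrow>\<^sub>E Obj C \<and>
    at_arc D \<in> (\<Pi>\<^sub>E e \<in> arcs G. Hom C (at_vert D (tail G e)) (at_vert D (head G e)))}"

definition coproduct_condition ::
  "('o, 'm) category \<Rightarrow> ('v, 'e) pre_digraph \<Rightarrow> ('v, 'e, 'o, 'm) diagram \<Rightarrow> bool" where
  "coproduct_condition C G D \<longleftrightarrow>
    (\<forall>v \<in> verts G. \<not> source_vertex G v \<longrightarrow>
      is_coproduct C (in_arcs G v) (\<lambda>e. at_vert D (tail G e)) (at_vert D v) (at_arc D))"

record ('v, 'e, 'o, 'm) diagram_morphism =
  mdom :: "('v, 'e, 'o, 'm) diagram"
  mcod :: "('v, 'e, 'o, 'm) diagram"
  component :: "'v \<Rightarrow> 'm"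

definition diagram_morphisms ::
  "('o, 'm) category \<Rightarrow> ('v, 'e) pre_digraph \<Rightarrow> ('v, 'e, 'o, 'm) diagram_morphism set" where
  "diagram_morphisms C G = {T.
    mdom T \<in> diagrams C G \<and> mcod T \<in> diagrams C G \<and>
    component T \<in> (\<Pi>\<^sub>E v \<in> verts G. Hom C (at_vert (mdom T) v) (at_vert (mcod T) v)) \<and>
    (\<forall>e \<in> arcs G. component T (head G e) \<cdot>\<^bsub>C\<^esub> at_arc (mdom T) e
                 = at_arc (mcod T) e \<cdot>\<^bsub>C\<^esub> component T (tail G e))}"

definition coproduct_diagrams ::
  "('o, 'm) category \<Rightarrow> ('v, 'e) pre_digraph
    \<Rightarrow> (('v, 'e, 'o, 'm) diagram, ('v, 'e, 'o, 'm) diagram_morphism) category" where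
  "coproduct_diagrams C G =
    \<lparr>Obj = {D \<in> diagrams C G. coproduct_condition C G D},
     Arr = {T \<in> diagram_morphisms C G.
       coproduct_condition C G (mdom T) \<and> coproduct_condition C G (mcod T)},
     Dom = mdom,
     Cod = mcod,
     Ident = (\<lambda>D. \<lparr>mdom = D, mcod = D, component = (\<lambda>v \<in> verts G. Ident C (at_vert D v))\<rparr>),
     Comp = (\<lambda>S T. \<lparr>mdom = mdom T, mcod = mcod S,
       component = (\<lambda>v \<in> verts G. component S v \<cdot>\<^bsub>C\<^esub> component T v)\<rparr>)\<rparr>"

end

theory Submission
  imports Defs
begin

text \<open>
  In the out-splitting, the arcs into a copy \<open>(v, n)\<close> of a vertex are the pairs \<open>(e, n)\<close>
  with \<open>e\<close> an arc into \<open>v\<close>, and the tail \<open>(tail G e, p (Inr e))\<close> of such an arc does not depend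
  on \<open>n\<close>.  So if a diagram \<open>E\<close> on the out-splitting satisfies the coproduct condition and \<open>v\<close> is
  not a source, then its objects at the copies of \<open>v\<close> are coproducts of one and the same family,
  hence canonically isomorphic.  A source has a single copy by the hypothesis on \<open>p\<close>.  Over every
  vertex there is thus a coherent system of isomorphisms \<open>transition E v m n\<close> from the copy \<open>m\<close>
  to the copy \<open>n\<close> (\<open>transition_refl\<close>, \<open>transition_trans\<close>), and by the uniqueness of maps out
  of a coproduct it is natural in \<open>E\<close> (\<open>transition_natural\<close>).

  A diagram on \<open>G\<close> spreads to the out-splitting by repeating it on all copies.  Conversely, a
  diagram \<open>E\<close> on the out-splitting collapses to its copies with index \<open>0\<close>; since an arc \<open>(e, 0)\<close>
  starts at the copy \<open>p (Inr e)\<close> of its tail, it has to be precomposed with the transition from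
  the copy \<open>0\<close> to that copy.  The collapsed diagram satisfies the coproduct condition, because a
  coproduct remains one when its summands are replaced by isomorphic objects
  (\<open>is_coproduct_iso_summands\<close>).

  All transitions of a spread diagram are identities, so collapsing after spreading is equal to
  the identity.  In the other order, the transitions from the copy \<open>0\<close> form an isomorphism from
  the spread collapsed diagram to \<open>E\<close> (\<open>counit_in_Hom\<close>), and their naturality in \<open>E\<close>
  makes the two functors mutually inverse up to isomorphism.
\<close>

section \<open>Coproducts in a category\<close>

lemma Obj_coproduct: "is_coproduct C I X P \<iota> \<Longrightarrow> P \<in> Obj C"
  by (simp add: is_coproduct_def)

lemma injection_in_Hom: "is_coproduct C I X P \<iota> \<Longrightarrow> i \<in> I \<Longrightarrow> \<iota> i \<in> Hom C (X i) P"
  by (simp add: is_coproduct_def)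

lemma coproduct_universal:
  assumes cop: "is_coproduct C I X P \<iota>" and Y: "Y \<in> Obj C"
    and f: "\<And>i. i \<in> I \<Longrightarrow> f i \<in> Hom C (X i) Y"
  shows "\<exists>!h. h \<in> Hom C P Y \<and> (\<forall>i\<in>I. h \<cdot>\<^bsub>C\<^esub> \<iota> i = f i)"
proof -
  have "\<forall>Y \<in> Obj C. \<forall>f. (\<forall>i \<in> I. f i \<in> Hom C (X i) Y) \<longrightarrow>
      (\<exists>!h. h \<in> Hom C P Y \<and> (\<forall>i \<in> I. h \<cdot>\<^bsub>C\<^esub> \<iota> i = f i))"
    using cop unfolding is_coproduct_def by (elim conjE)
  from this[THEN bspec, OF Y, THEN spec, of f] f show ?thesis
    by (elim impE) simp_all
qed

lemma is_coproductI:
  assumes "P \<in> Obj C" and "\<And>i. i \<in> I \<Longrightarrow> X i \<in> Obj C" and "\<And>i. i \<in> I \<Longrightarrow> \<iota> i \<in> Hom C (X i) P"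
    and "\<And>Y f. Y \<in> Obj C \<Longrightarrow> (\<And>i. i \<in> I \<Longrightarrow> f i \<in> Hom C (X i) Y) \<Longrightarrow>
      \<exists>!h. h \<in> Hom C P Y \<and> (\<forall>i\<in>I. h \<cdot>\<^bsub>C\<^esub> \<iota> i = f i)"
  shows "is_coproduct C I X P \<iota>"
  unfolding is_coproduct_def using assms(1-3) by (intro conjI ballI allI impI assms(4)) simp_all

lemma Obj_summand: "is_coproduct C I X P \<iota> \<Longrightarrow> i \<in> I \<Longrightarrow> X i \<in> Obj C"
  by (simp add: is_coproduct_def)

lemma is_coproduct_cong:
  assumes "\<And>i. i \<in> I \<Longrightarrow> X i = X' i" and "\<And>i. i \<in> I \<Longrightarrow> \<iota> i = \<iota>' i"
  shows "is_coproduct C I X P \<iota> \<longleftrightarrow> is_coproduct C I X' P \<iota>'"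
  using assms unfolding is_coproduct_def by simp

lemma is_coproduct_reindex:
  assumes inj: "inj_on k I"
  shows "is_coproduct C (k ` I) X P \<iota> \<longleftrightarrow> is_coproduct C I (\<lambda>i. X (k i)) P (\<lambda>i. \<iota> (k i))"
    (is "?L \<longleftrightarrow> ?R")
proof
  assume L: ?L
  show ?R
  proof (rule is_coproductI)
    fix Y f assume Y: "Y \<in> Obj C" and f: "\<And>i. i \<in> I \<Longrightarrow> f i \<in> Hom C (X (k i)) Y"
    \<comment> \<open>A family over the index set is transported to its image along the inverse of the bijection.\<close>
    have "f (inv_into I k j) \<in> Hom C (X j) Y" if "j \<in> k ` I" for j
      using f[of "inv_into I k j"] that by (simp add: inv_into_into f_inv_into_f)
    from coproduct_universal[OF L Y, of "\<lambda>j. f (inv_into I k j)", OF this]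
    show "\<exists>!h. h \<in> Hom C P Y \<and> (\<forall>i\<in>I. h \<cdot>\<^bsub>C\<^esub> \<iota> (k i) = f i)"
      using inj by simp
  qed (use L in \<open>auto dest: Obj_coproduct Obj_summand injection_in_Hom\<close>)
next
  assume R: ?R
  show ?L
  proof (rule is_coproductI)
    fix Y f assume Y: "Y \<in> Obj C" and f: "\<And>j. j \<in> k ` I \<Longrightarrow> f j \<in> Hom C (X j) Y"
    from coproduct_universal[OF R Y, of "\<lambda>i. f (k i)", OF f]
    show "\<exists>!h. h \<in> Hom C P Y \<and> (\<forall>j\<in>k ` I. h \<cdot>\<^bsub>C\<^esub> \<iota> j = f j)"
      by simp
  qed (use R in \<open>auto dest: Obj_coproduct Obj_summand injection_in_Hom\<close>)
qed

context category
begin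

lemma Hom_objects: "f \<in> Hom C a b \<Longrightarrow> a \<in> Obj C \<and> b \<in> Obj C"
  unfolding Hom_def using Dom_in_Obj Cod_in_Obj by auto

lemma coproduct_ext:
  assumes cop: "is_coproduct C I X P \<iota>"
    and h: "h \<in> Hom C P Y" and k: "k \<in> Hom C P Y"
    and eq: "\<And>i. i \<in> I \<Longrightarrow> h \<cdot> \<iota> i = k \<cdot> \<iota> i"
  shows "h = k"
proof -
  have "k \<cdot> \<iota> i \<in> Hom C (X i) Y" if "i \<in> I" for i
    using Comp_in_Hom[OF injection_in_Hom[OF cop that] k] .
  then have "\<exists>!l. l \<in> Hom C P Y \<and> (\<forall>i\<in>I. l \<cdot> \<iota> i = k \<cdot> \<iota> i)"
    using Hom_objects[OF k] by (intro coproduct_universal[OF cop]) simp_all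
  then show ?thesis using h k eq by blast
qed

lemma isomorphismI:
  assumes "f \<in> Hom C a b" and "g \<in> Hom C b a" and "g \<cdot> f = Ident C a" and "f \<cdot> g = Ident C b"
  shows "isomorphism C f"
  using assms unfolding isomorphism_def Hom_def by auto

lemma isomorphismE:
  assumes "isomorphism C f" and "f \<in> Hom C a b"
  obtains g where "g \<in> Hom C b a" and "g \<cdot> f = Ident C a" and "f \<cdot> g = Ident C b"
  using assms unfolding isomorphism_def by (auto simp: Hom_def)

lemma isomorphism_Ident: "a \<in> Obj C \<Longrightarrow> isomorphism C (Ident C a)"
  using Ident_in_Hom Comp_Ident_left by (intro isomorphismI[of _ a a]) auto

text \<open>
  A family of maps out of the new summands corresponds, by composing with the inverses of the
  isomorphisms, to a family out of the old ones, and both families have the same factorizations.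
\<close>

lemma is_coproduct_iso_summands:
  assumes cop: "is_coproduct C I X P \<iota>"
    and c: "\<And>i. i \<in> I \<Longrightarrow> c i \<in> Hom C (X' i) (X i)"
    and iso: "\<And>i. i \<in> I \<Longrightarrow> isomorphism C (c i)"
  shows "is_coproduct C I X' P (\<lambda>i. \<iota> i \<cdot> c i)"
proof -
  have "\<exists>g. g \<in> Hom C (X i) (X' i) \<and> g \<cdot> c i = Ident C (X' i) \<and> c i \<cdot> g = Ident C (X i)"
    if "i \<in> I" for i
    using isomorphismE[OF iso c] that by metis
  then obtain d where d: "\<And>i. i \<in> I \<Longrightarrow> d i \<in> Hom C (X i) (X' i)"
    and dc: "\<And>i. i \<in> I \<Longrightarrow> d i \<cdot> c i = Ident C (X' i)"
    and cd: "\<And>i. i \<in> I \<Longrightarrow> c i \<cdot> d i = Ident C (X i)"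
    by metis
  note inj = injection_in_Hom[OF cop]
  have factor: "\<exists>!h. h \<in> Hom C P Y \<and> (\<forall>i\<in>I. h \<cdot> (\<iota> i \<cdot> c i) = f i)"
    if Y: "Y \<in> Obj C" and f: "\<And>i. i \<in> I \<Longrightarrow> f i \<in> Hom C (X' i) Y" for Y f
  proof -
    have "h \<cdot> (\<iota> i \<cdot> c i) = f i \<longleftrightarrow> h \<cdot> \<iota> i = f i \<cdot> d i" if h: "h \<in> Hom C P Y" and i: "i \<in> I" for h i
    proof
      assume "h \<cdot> (\<iota> i \<cdot> c i) = f i"
      then have "f i \<cdot> d i = ((h \<cdot> \<iota> i) \<cdot> c i) \<cdot> d i"
        by (simp add: Comp_assoc[OF c[OF i] inj[OF i] h])
      also have "\<dots> = h \<cdot> \<iota> i"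
        using Comp_assoc[OF d[OF i] c[OF i] Comp_in_Hom[OF inj[OF i] h]] cd[OF i]
          Comp_Ident_right[OF Comp_in_Hom[OF inj[OF i] h]] by simp
      finally show "h \<cdot> \<iota> i = f i \<cdot> d i" by simp
    next
      assume "h \<cdot> \<iota> i = f i \<cdot> d i"
      then have "h \<cdot> (\<iota> i \<cdot> c i) = (f i \<cdot> d i) \<cdot> c i"
        using Comp_assoc[OF c[OF i] inj[OF i] h] by simp
      also have "\<dots> = f i"
        using Comp_assoc[OF c[OF i] d[OF i] f[OF i]] dc[OF i] Comp_Ident_right[OF f[OF i]] by simp
      finally show "h \<cdot> (\<iota> i \<cdot> c i) = f i" .
    qed
    then have same: "h \<in> Hom C P Y \<and> (\<forall>i\<in>I. h \<cdot> (\<iota> i \<cdot> c i) = f i)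
        \<longleftrightarrow> h \<in> Hom C P Y \<and> (\<forall>i\<in>I. h \<cdot> \<iota> i = f i \<cdot> d i)" for h
      by blast
    show ?thesis
      unfolding same using coproduct_universal[OF cop Y, of "\<lambda>i. f i \<cdot> d i"] Comp_in_Hom[OF d f]
      by simp
  qed
  show ?thesis
    using Obj_coproduct[OF cop] Hom_objects[OF c] Comp_in_Hom[OF c inj]
    by (intro is_coproductI factor) simp_all
qed

end


section \<open>The category of diagrams satisfying the coproduct condition\<close>

lemma coproduct_diagrams_sel [simp]:
  "Obj (coproduct_diagrams C G) = {D \<in> diagrams C G. coproduct_condition C G D}"
  "Dom (coproduct_diagrams C G) = mdom"
  "Cod (coproduct_diagrams C G) = mcod"
  "Ident (coproduct_diagrams C G) D =
    \<lparr>mdom = D, mcod = D, component = (\<lambda>v \<in> verts G. Ident C (at_vert D v))\<rparr>"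
  "S \<cdot>\<^bsub>coproduct_diagrams C G\<^esub> T = \<lparr>mdom = mdom T, mcod = mcod S,
     component = (\<lambda>v \<in> verts G. component S v \<cdot>\<^bsub>C\<^esub> component T v)\<rparr>"
  by (simp_all add: coproduct_diagrams_def)

lemma Hom_coproduct_diagrams:
  "T \<in> Hom (coproduct_diagrams C G) D E \<longleftrightarrow>
    mdom T = D \<and> mcod T = E \<and>
    D \<in> Obj (coproduct_diagrams C G) \<and> E \<in> Obj (coproduct_diagrams C G) \<and>
    component T \<in> (\<Pi>\<^sub>E v \<in> verts G. Hom C (at_vert D v) (at_vert E v)) \<and>
    (\<forall>e \<in> arcs G. component T (head G e) \<cdot>\<^bsub>C\<^esub> at_arc D e
      = at_arc E e \<cdot>\<^bsub>C\<^esub> component T (tail G e))"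
  by (auto simp: Hom_def coproduct_diagrams_def diagram_morphisms_def)

lemma diagram_morphism_eqI:
  assumes "S \<in> Hom (coproduct_diagrams C G) D E" and "T \<in> Hom (coproduct_diagrams C G) D E"
    and "\<And>v. v \<in> verts G \<Longrightarrow> component S v = component T v"
  shows "S = T"
proof (rule diagram_morphism.equality)
  show "component S = component T"
    using assms unfolding Hom_coproduct_diagrams by (blast intro: PiE_ext)
qed (use assms in \<open>simp_all add: Hom_coproduct_diagrams\<close>)

lemma diagram_eqI:
  assumes "D \<in> diagrams C G" and "E \<in> diagrams C G"
    and "\<And>v. v \<in> verts G \<Longrightarrow> at_vert D v = at_vert E v"
    and "\<And>e. e \<in> arcs G \<Longrightarrow> at_arc D e = at_arc E e"
  shows "D = E"
proof (rule diagram.equality)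
  show verts: "at_vert D = at_vert E"
    using assms unfolding diagrams_def by (blast intro: PiE_ext)
  have "at_arc D \<in> (\<Pi>\<^sub>E e \<in> arcs G. Hom C (at_vert D (tail G e)) (at_vert D (head G e)))"
    "at_arc E \<in> (\<Pi>\<^sub>E e \<in> arcs G. Hom C (at_vert D (tail G e)) (at_vert D (head G e)))"
    using assms(1,2) verts by (simp_all add: diagrams_def)
  then show "at_arc D = at_arc E"
    using assms(4) by (rule PiE_ext)
qed simp

locale shaped_diagrams = category C + wf_digraph G
  for C :: "('o, 'm) category" (structure) and G :: "('v, 'e) pre_digraph"
begin

abbreviation "\<D> \<equiv> coproduct_diagrams C G"

lemma at_vert_in_Obj: "D \<in> Obj \<D> \<Longrightarrow> v \<in> verts G \<Longrightarrow> at_vert D v \<in> Obj C"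
  by (auto simp: diagrams_def)

lemma at_arc_in_Hom:
  "D \<in> Obj \<D> \<Longrightarrow> e \<in> arcs G \<Longrightarrow> at_arc D e \<in> Hom C (at_vert D (tail G e)) (at_vert D (head G e))"
  by (auto simp: diagrams_def)

lemma component_in_Hom:
  "T \<in> Hom \<D> D E \<Longrightarrow> v \<in> verts G \<Longrightarrow> component T v \<in> Hom C (at_vert D v) (at_vert E v)"
  by (auto simp: Hom_coproduct_diagrams)

lemma component_square:
  "T \<in> Hom \<D> D E \<Longrightarrow> e \<in> arcs G \<Longrightarrow>
    component T (head G e) \<cdot> at_arc D e = at_arc E e \<cdot> component T (tail G e)"
  by (auto simp: Hom_coproduct_diagrams)

lemma Comp_diagram_morphisms:
  assumes S: "S \<in> Hom \<D> D E" and T: "T \<in> Hom \<D> E F"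
  shows "T \<cdot>\<^bsub>\<D>\<^esub> S \<in> Hom \<D> D F"
proof -
  have D: "D \<in> Obj \<D>" and E: "E \<in> Obj \<D>" and F: "F \<in> Obj \<D>"
    using S T by (auto simp: Hom_coproduct_diagrams)
  have "(component T (head G e) \<cdot> component S (head G e)) \<cdot> at_arc D e
      = at_arc F e \<cdot> (component T (tail G e) \<cdot> component S (tail G e))" if e: "e \<in> arcs G" for e
  proof -
    have "(component T (head G e) \<cdot> component S (head G e)) \<cdot> at_arc D e
        = component T (head G e) \<cdot> (at_arc E e \<cdot> component S (tail G e))"
      using Comp_assoc[OF at_arc_in_Hom[OF D e] component_in_Hom[OF S] component_in_Hom[OF T]]
        component_square[OF S e] head_in_verts[OF e] by simp
    also have "\<dots> = (at_arc F e \<cdot> component T (tail G e)) \<cdot> component S (tail G e)"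
      using Comp_assoc[OF component_in_Hom[OF S] at_arc_in_Hom[OF E e] component_in_Hom[OF T]]
        component_square[OF T e] head_in_verts[OF e] tail_in_verts[OF e] by simp
    also have "\<dots> = at_arc F e \<cdot> (component T (tail G e) \<cdot> component S (tail G e))"
      using Comp_assoc[OF component_in_Hom[OF S] component_in_Hom[OF T] at_arc_in_Hom[OF F e]]
        tail_in_verts[OF e] by simp
    finally show ?thesis .
  qed
  then show ?thesis
    using S T D F Comp_in_Hom[OF component_in_Hom[OF S] component_in_Hom[OF T]]
    unfolding Hom_coproduct_diagrams[of _ _ _ D F] by (auto simp: Hom_coproduct_diagrams)
qed

lemma Ident_diagram_morphism:
  assumes D: "D \<in> Obj \<D>"
  shows "Ident \<D> D \<in> Hom \<D> D D"
  unfolding Hom_coproduct_diagrams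
  using D at_vert_in_Obj[OF D] Ident_in_Hom
    Comp_Ident_left[OF at_arc_in_Hom[OF D]] Comp_Ident_right[OF at_arc_in_Hom[OF D]]
  by auto

lemma category_coproduct_diagrams: "category \<D>"
proof
  fix f assume "f \<in> Arr \<D>"
  then show "Dom \<D> f \<in> Obj \<D>" "Cod \<D> f \<in> Obj \<D>"
    by (auto simp: coproduct_diagrams_def diagram_morphisms_def)
next
  fix D assume "D \<in> Obj \<D>"
  then show "Ident \<D> D \<in> Hom \<D> D D" by (rule Ident_diagram_morphism)
next
  fix S D E T F assume "S \<in> Hom \<D> D E" "T \<in> Hom \<D> E F"
  then show "T \<cdot>\<^bsub>\<D>\<^esub> S \<in> Hom \<D> D F" by (rule Comp_diagram_morphisms)
next
  fix T D E assume T: "T \<in> Hom \<D> D E"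
  then have D: "D \<in> Obj \<D>" and E: "E \<in> Obj \<D>" by (auto simp: Hom_coproduct_diagrams)
  show "Ident \<D> E \<cdot>\<^bsub>\<D>\<^esub> T = T"
    using Comp_Ident_left[OF component_in_Hom[OF T]]
    by (intro diagram_morphism_eqI[OF Comp_diagram_morphisms[OF T Ident_diagram_morphism[OF E]] T]) simp
  show "T \<cdot>\<^bsub>\<D>\<^esub> Ident \<D> D = T"
    using Comp_Ident_right[OF component_in_Hom[OF T]]
    by (intro diagram_morphism_eqI[OF Comp_diagram_morphisms[OF Ident_diagram_morphism[OF D] T] T]) simp
next
  fix S D E T F U K
  assume S: "S \<in> Hom \<D> D E" and T: "T \<in> Hom \<D> E F" and U: "U \<in> Hom \<D> F K"
  show "(U \<cdot>\<^bsub>\<D>\<^esub> T) \<cdot>\<^bsub>\<D>\<^esub> S = U \<cdot>\<^bsub>\<D>\<^esub> (T \<cdot>\<^bsub>\<D>\<^esub> S)"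
    using Comp_assoc[OF component_in_Hom[OF S] component_in_Hom[OF T] component_in_Hom[OF U]]
    by (intro diagram_morphism_eqI[OF
          Comp_diagram_morphisms[OF S Comp_diagram_morphisms[OF T U]]
          Comp_diagram_morphisms[OF Comp_diagram_morphisms[OF S T] U]]) simp
qed

text \<open>
  The componentwise inverses form a morphism of diagrams again: the square of the inverse at an
  arc is the given square composed with inverses on both sides.
\<close>

lemma isomorphism_of_diagrams:
  assumes T: "T \<in> Hom \<D> D E"
    and iso: "\<And>v. v \<in> verts G \<Longrightarrow> isomorphism C (component T v)"
  shows "isomorphism \<D> T"
proof -
  interpret DD: category \<D> by (rule category_coproduct_diagrams)
  have D: "D \<in> Obj \<D>" and E: "E \<in> Obj \<D>" using T by (auto simp: Hom_coproduct_diagrams)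
  note t = component_in_Hom[OF T]
  have "\<exists>g. g \<in> Hom C (at_vert E v) (at_vert D v) \<and> g \<cdot> component T v = Ident C (at_vert D v)
      \<and> component T v \<cdot> g = Ident C (at_vert E v)" if "v \<in> verts G" for v
    using isomorphismE[OF iso t] that by metis
  then obtain g where g: "\<And>v. v \<in> verts G \<Longrightarrow> g v \<in> Hom C (at_vert E v) (at_vert D v)"
    and gt: "\<And>v. v \<in> verts G \<Longrightarrow> g v \<cdot> component T v = Ident C (at_vert D v)"
    and tg: "\<And>v. v \<in> verts G \<Longrightarrow> component T v \<cdot> g v = Ident C (at_vert E v)"
    by metis
  define S where "S = \<lparr>mdom = E, mcod = D, component = restrict g (verts G)\<rparr>"
  have "g (head G e) \<cdot> at_arc E e = at_arc D e \<cdot> g (tail G e)" if e: "e \<in> arcs G" for e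
  proof -
    let ?h = "head G e" and ?t = "tail G e"
    have h: "?h \<in> verts G" and tl: "?t \<in> verts G" using e by auto
    have "g ?h \<cdot> at_arc E e = g ?h \<cdot> (at_arc E e \<cdot> (component T ?t \<cdot> g ?t))"
      using tg[OF tl] Comp_Ident_right[OF at_arc_in_Hom[OF E e]] by simp
    also have "\<dots> = g ?h \<cdot> ((component T ?h \<cdot> at_arc D e) \<cdot> g ?t)"
      using Comp_assoc[OF g[OF tl] t[OF tl] at_arc_in_Hom[OF E e]] component_square[OF T e] by simp
    also have "\<dots> = g ?h \<cdot> (component T ?h \<cdot> (at_arc D e \<cdot> g ?t))"
      using Comp_assoc[OF g[OF tl] at_arc_in_Hom[OF D e] t[OF h]] by simp
    also have "\<dots> = (g ?h \<cdot> component T ?h) \<cdot> (at_arc D e \<cdot> g ?t)"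
      using Comp_assoc[OF Comp_in_Hom[OF g[OF tl] at_arc_in_Hom[OF D e]] t[OF h] g[OF h]] by simp
    also have "\<dots> = at_arc D e \<cdot> g ?t"
      using gt[OF h] Comp_Ident_left[OF Comp_in_Hom[OF g[OF tl] at_arc_in_Hom[OF D e]]] by simp
    finally show ?thesis .
  qed
  then have S: "S \<in> Hom \<D> E D"
    using D E g by (auto simp: Hom_coproduct_diagrams S_def)
  show ?thesis
  proof (rule DD.isomorphismI[OF T S])
    show "S \<cdot>\<^bsub>\<D>\<^esub> T = Ident \<D> D"
      using gt by (intro diagram_morphism_eqI[OF DD.Comp_in_Hom[OF T S] DD.Ident_in_Hom[OF D]])
        (simp add: S_def)
    show "T \<cdot>\<^bsub>\<D>\<^esub> S = Ident \<D> E"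
      using tg by (intro diagram_morphism_eqI[OF DD.Comp_in_Hom[OF S T] DD.Ident_in_Hom[OF E]])
        (simp add: S_def)
  qed
qed

end


section \<open>Identity functors and composites\<close>

lemma cat_functor_id:
  assumes "category A" shows "cat_functor A A id_functor"
proof -
  interpret category A by fact
  show ?thesis by unfold_locales (simp_all add: id_functor_def)
qed

lemma cat_functor_comp:
  assumes F: "cat_functor A B F" and K: "cat_functor B C K"
  shows "cat_functor A C (comp_functor K F)"
proof -
  interpret F: cat_functor A B F by fact
  interpret K: cat_functor B C K by fact
  show ?thesis
  proof
    fix f a b assume f: "f \<in> Hom A a b"
    show "ArrMap (comp_functor K F) f
        \<in> Hom C (ObjMap (comp_functor K F) a) (ObjMap (comp_functor K F) b)"
      using K.ArrMap_in_Hom[OF F.ArrMap_in_Hom[OF f]] by (simp add: comp_functor_def)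
  next
    fix f g a b c assume f: "f \<in> Hom A a b" and g: "g \<in> Hom A b c"
    show "ArrMap (comp_functor K F) (g \<cdot>\<^bsub>A\<^esub> f)
        = ArrMap (comp_functor K F) g \<cdot>\<^bsub>C\<^esub> ArrMap (comp_functor K F) f"
      using F.ArrMap_Comp[OF f g] K.ArrMap_Comp[OF F.ArrMap_in_Hom[OF f] F.ArrMap_in_Hom[OF g]]
      by (simp add: comp_functor_def)
  qed (simp_all add: comp_functor_def F.ObjMap_in_Obj K.ObjMap_in_Obj F.ArrMap_Ident K.ArrMap_Ident)
qed


section \<open>The copies of a vertex in an out-splitting\<close>

locale out_split = shaped_diagrams C G
  for C :: "('o, 'm) category" (structure) and G :: "('v, 'e) pre_digraph" +
  fixes p :: "'v + 'e \<Rightarrow> nat"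
  assumes arc_bound: "e \<in> arcs G \<Longrightarrow> p (Inr e) \<le> p (Inl (tail G e))"
    and source_bound: "source_vertex G v \<Longrightarrow> p (Inl v) = 0"
begin

abbreviation "H \<equiv> out_splitting G p"

lemma out_splitting_sel [simp]:
  "(v, n) \<in> verts H \<longleftrightarrow> v \<in> verts G \<and> n \<le> p (Inl v)"
  "(e, n) \<in> arcs H \<longleftrightarrow> e \<in> arcs G \<and> n \<le> p (Inl (head G e))"
  "tail H (e, n) = (tail G e, p (Inr e))"
  "head H (e, n) = (head G e, n)"
  by (simp_all add: out_splitting_def)

lemma in_arcs_out_splitting: "(v, n) \<in> verts H \<Longrightarrow> in_arcs H (v, n) = (\<lambda>e. (e, n)) ` in_arcs G v"
  by (auto simp: in_arcs_def image_iff)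

lemma source_vertex_out_splitting:
  "(v, n) \<in> verts H \<Longrightarrow> source_vertex H (v, n) \<longleftrightarrow> source_vertex G v"
  by (simp add: source_vertex_def in_arcs_out_splitting)

sublocale split: shaped_diagrams C H
proof
  fix x assume "x \<in> arcs H"
  then show "tail H x \<in> verts H" "head H x \<in> verts H"
    using arc_bound by (cases x; simp)+
qed

abbreviation "\<D>' \<equiv> coproduct_diagrams C H"

text \<open>
  Reindexing by \<open>e \<mapsto> (e, n)\<close> makes all copies of \<open>v\<close> coproducts of literally the same family,
  indexed by the arcs into \<open>v\<close>.
\<close>

lemma coproduct_condition_out_splitting:
  "coproduct_condition C H E \<longleftrightarrow>
    (\<forall>v n. (v, n) \<in> verts H \<longrightarrow> \<not> source_vertex G v \<longrightarrow>
      is_coproduct C (in_arcs G v) (\<lambda>e. at_vert E (tail G e, p (Inr e)))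
        (at_vert E (v, n)) (\<lambda>e. at_arc E (e, n)))"
proof -
  have "is_coproduct C (in_arcs H (v, n)) (\<lambda>x. at_vert E (tail H x)) (at_vert E (v, n)) (at_arc E)
    \<longleftrightarrow> is_coproduct C (in_arcs G v) (\<lambda>e. at_vert E (tail G e, p (Inr e)))
        (at_vert E (v, n)) (\<lambda>e. at_arc E (e, n))" if "(v, n) \<in> verts H" for v n
    unfolding in_arcs_out_splitting[OF that]
    by (subst is_coproduct_reindex) (auto simp: inj_on_def)
  then show ?thesis
    unfolding coproduct_condition_def
    by (simp only: split_paired_Ball_Sigma split_paired_All Ball_def source_vertex_out_splitting
        cong: imp_cong)
qed

lemma copy_coproduct:
  assumes "E \<in> Obj \<D>'" and "(v, n) \<in> verts H" and "\<not> source_vertex G v"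
  shows "is_coproduct C (in_arcs G v) (\<lambda>e. at_vert E (tail G e, p (Inr e)))
    (at_vert E (v, n)) (\<lambda>e. at_arc E (e, n))"
  using assms by (simp add: coproduct_condition_out_splitting)

text \<open>
  At a vertex with incoming arcs a transition is the comparison of two coproducts of the same
  family.  At a source the coproduct condition gives no control over maps out of the object, so
  the identity is prescribed; this is well-typed because a source has only one copy.
\<close>

definition is_transition ::
  "('v \<times> nat, 'e \<times> nat, 'o, 'm) diagram \<Rightarrow> 'v \<Rightarrow> nat \<Rightarrow> nat \<Rightarrow> 'm \<Rightarrow> bool" where
  "is_transition E v m n h \<longleftrightarrow> h \<in> Hom C (at_vert E (v, m)) (at_vert E (v, n)) \<and>
    (if source_vertex G v then h = Ident C (at_vert E (v, m))
     else \<forall>e \<in> in_arcs G v. h \<cdot> at_arc E (e, m) = at_arc E (e, n))"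

definition transition ::
  "('v \<times> nat, 'e \<times> nat, 'o, 'm) diagram \<Rightarrow> 'v \<Rightarrow> nat \<Rightarrow> nat \<Rightarrow> 'm" where
  "transition E v m n = (THE h. is_transition E v m n h)"

lemma source_copies_eq:
  assumes "source_vertex G v" and "(v, m) \<in> verts H" and "(v, n) \<in> verts H"
  shows "m = n"
  using assms source_bound[OF assms(1)] by simp

lemma ex1_transition:
  assumes E: "E \<in> Obj \<D>'" and m: "(v, m) \<in> verts H" and n: "(v, n) \<in> verts H"
  shows "\<exists>!h. is_transition E v m n h"
proof (cases "source_vertex G v")
  case True
  then show ?thesis
    using source_copies_eq[OF True m n] Ident_in_Hom[OF split.at_vert_in_Obj[OF E n]]
    by (auto simp: is_transition_def)
next
  case False
  from coproduct_universal[OF copy_coproduct[OF E m False] split.at_vert_in_Obj[OF E n],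
      of "\<lambda>e. at_arc E (e, n)", OF injection_in_Hom[OF copy_coproduct[OF E n False]]]
  show ?thesis
    using False by (simp add: is_transition_def)
qed

lemma is_transition_transition:
  "E \<in> Obj \<D>' \<Longrightarrow> (v, m) \<in> verts H \<Longrightarrow> (v, n) \<in> verts H \<Longrightarrow>
    is_transition E v m n (transition E v m n)"
  unfolding transition_def by (rule theI') (rule ex1_transition)

lemma transition_eqI:
  "E \<in> Obj \<D>' \<Longrightarrow> (v, m) \<in> verts H \<Longrightarrow> (v, n) \<in> verts H \<Longrightarrow>
    is_transition E v m n h \<Longrightarrow> transition E v m n = h"
  unfolding transition_def by (rule the1_equality) (rule ex1_transition)

lemma transition_in_Hom:
  "E \<in> Obj \<D>' \<Longrightarrow> (v, m) \<in> verts H \<Longrightarrow> (v, n) \<in> verts H \<Longrightarrow>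
    transition E v m n \<in> Hom C (at_vert E (v, m)) (at_vert E (v, n))"
  using is_transition_transition by (simp add: is_transition_def)

lemma transition_at_arc:
  assumes E: "E \<in> Obj \<D>'" and e: "e \<in> arcs G" "m \<le> p (Inl (head G e))" "n \<le> p (Inl (head G e))"
  shows "transition E (head G e) m n \<cdot> at_arc E (e, m) = at_arc E (e, n)"
proof -
  have "e \<in> in_arcs G (head G e)" using e by (simp add: in_arcs_def)
  moreover from this have "\<not> source_vertex G (head G e)" by (auto simp: source_vertex_def)
  ultimately show ?thesis
    using is_transition_transition[OF E, of "head G e" m n] e by (simp add: is_transition_def)
qed

lemma transition_refl:
  assumes E: "E \<in> Obj \<D>'" and m: "(v, m) \<in> verts H"
  shows "transition E v m m = Ident C (at_vert E (v, m))"
proof (rule transition_eqI[OF E m m])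
  have "Ident C (at_vert E (v, m)) \<cdot> at_arc E (e, m) = at_arc E (e, m)" if "e \<in> in_arcs G v" for e
    using split.at_arc_in_Hom[OF E, of "(e, m)"] that m
    by (auto simp: in_arcs_def intro: Comp_Ident_left)
  then show "is_transition E v m m (Ident C (at_vert E (v, m)))"
    using Ident_in_Hom[OF split.at_vert_in_Obj[OF E m]] by (simp add: is_transition_def)
qed

text \<open>
  Away from the sources, both sides turn the injections of the copy \<open>k\<close> into those of the copy
  \<open>n\<close>, and a map out of a coproduct is determined by that.
\<close>

lemma transition_trans:
  assumes E: "E \<in> Obj \<D>'" and k: "(v, k) \<in> verts H" and m: "(v, m) \<in> verts H"
    and n: "(v, n) \<in> verts H"
  shows "transition E v m n \<cdot> transition E v k m = transition E v k n"
proof -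
  note km = transition_in_Hom[OF E k m] and mn = transition_in_Hom[OF E m n]
  show ?thesis
  proof (cases "source_vertex G v")
    case True
    have "m = k" "n = k" using source_copies_eq[OF True _ k] m n by auto
    then show ?thesis
      using transition_refl[OF E k] Comp_Ident_left[OF Ident_in_Hom[OF split.at_vert_in_Obj[OF E k]]]
      by simp
  next
    case False
    show ?thesis
    proof (rule coproduct_ext[OF copy_coproduct[OF E k False] Comp_in_Hom[OF km mn]
          transition_in_Hom[OF E k n]])
      fix e assume "e \<in> in_arcs G v"
      then have e: "e \<in> arcs G" "head G e = v" by (auto simp: in_arcs_def)
      have "at_arc E (e, k) \<in> Hom C (at_vert E (tail H (e, k))) (at_vert E (v, k))"
        using split.at_arc_in_Hom[OF E, of "(e, k)"] e k by simp
      from Comp_assoc[OF this km mn]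
      show "(transition E v m n \<cdot> transition E v k m) \<cdot> at_arc E (e, k)
          = transition E v k n \<cdot> at_arc E (e, k)"
        using transition_at_arc[OF E e(1)] e k m n by simp
    qed
  qed
qed

lemma isomorphism_transition:
  assumes E: "E \<in> Obj \<D>'" and m: "(v, m) \<in> verts H" and n: "(v, n) \<in> verts H"
  shows "isomorphism C (transition E v m n)"
  using transition_trans[OF E m n m] transition_trans[OF E n m n]
    transition_refl[OF E m] transition_refl[OF E n]
  by (intro isomorphismI[OF transition_in_Hom[OF E m n] transition_in_Hom[OF E n m]]) simp_all

text \<open>
  Both sides are maps out of a coproduct, and on the summand of an arc both are the arrow at
  that arc composed with the component at its tail.
\<close>

lemma transition_natural:
  assumes T: "T \<in> Hom \<D>' E F" and m: "(v, m) \<in> verts H" and n: "(v, n) \<in> verts H"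
  shows "component T (v, n) \<cdot> transition E v m n = transition F v m n \<cdot> component T (v, m)"
proof -
  have E: "E \<in> Obj \<D>'" and F: "F \<in> Obj \<D>'" using T by (auto simp: Hom_coproduct_diagrams)
  note tE = transition_in_Hom[OF E m n] and tF = transition_in_Hom[OF F m n]
    and Tm = split.component_in_Hom[OF T m] and Tn = split.component_in_Hom[OF T n]
  show ?thesis
  proof (cases "source_vertex G v")
    case True
    then have "n = m" using source_copies_eq[OF True m n] by simp
    then show ?thesis
      using transition_refl[OF E m] transition_refl[OF F m] Comp_Ident_left[OF Tm]
        Comp_Ident_right[OF Tm] by simp
  next
    case False
    show ?thesis
    proof (rule coproduct_ext[OF copy_coproduct[OF E m False] Comp_in_Hom[OF tE Tn]
          Comp_in_Hom[OF Tm tF]])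
      fix e assume "e \<in> in_arcs G v"
      then have e: "e \<in> arcs G" and v: "head G e = v" by (auto simp: in_arcs_def)
      let ?t = "(tail G e, p (Inr e))"
      have em: "(e, m) \<in> arcs H" and en: "(e, n) \<in> arcs H" using e v m n by auto
      have Em: "at_arc E (e, m) \<in> Hom C (at_vert E ?t) (at_vert E (v, m))"
        and Fm: "at_arc F (e, m) \<in> Hom C (at_vert F ?t) (at_vert F (v, m))"
        using split.at_arc_in_Hom[OF _ em] E F v by auto
      have Tt: "component T ?t \<in> Hom C (at_vert E ?t) (at_vert F ?t)"
        using split.component_in_Hom[OF T, of ?t] e arc_bound by simp
      have "(component T (v, n) \<cdot> transition E v m n) \<cdot> at_arc E (e, m)
          = component T (v, n) \<cdot> at_arc E (e, n)"
        using Comp_assoc[OF Em tE Tn] transition_at_arc[OF E e] v m n by simp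
      also have "\<dots> = at_arc F (e, n) \<cdot> component T ?t"
        using split.component_square[OF T en] v by simp
      also have "\<dots> = transition F v m n \<cdot> (at_arc F (e, m) \<cdot> component T ?t)"
        using Comp_assoc[OF Tt Fm tF] transition_at_arc[OF F e] v m n by simp
      also have "\<dots> = (transition F v m n \<cdot> component T (v, m)) \<cdot> at_arc E (e, m)"
        using Comp_assoc[OF Em Tm tF] split.component_square[OF T em] v by simp
      finally show "(component T (v, n) \<cdot> transition E v m n) \<cdot> at_arc E (e, m)
          = (transition F v m n \<cdot> component T (v, m)) \<cdot> at_arc E (e, m)" .
    qed
  qed
qed


section \<open>Spreading a diagram over the copies, and collapsing the copies\<close>

definition spread_diagram ::
  "('v, 'e, 'o, 'm) diagram \<Rightarrow> ('v \<times> nat, 'e \<times> nat, 'o, 'm) diagram" where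
  "spread_diagram D = \<lparr>at_vert = (\<lambda>x \<in> verts H. at_vert D (fst x)),
     at_arc = (\<lambda>x \<in> arcs H. at_arc D (fst x))\<rparr>"

definition spread_functor where
  "spread_functor = \<lparr>ObjMap = spread_diagram,
     ArrMap = (\<lambda>T. \<lparr>mdom = spread_diagram (mdom T), mcod = spread_diagram (mcod T),
       component = (\<lambda>x \<in> verts H. component T (fst x))\<rparr>)\<rparr>"

text \<open>
  The arrow at \<open>(e, 0)\<close> starts at the copy \<open>p (Inr e)\<close> of the tail of \<open>e\<close>, while the collapsed
  diagram only retains the copy \<open>0\<close>; the transition bridges the two.
\<close>

definition collapse_diagram ::
  "('v \<times> nat, 'e \<times> nat, 'o, 'm) diagram \<Rightarrow> ('v, 'e, 'o, 'm) diagram" where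
  "collapse_diagram E = \<lparr>at_vert = (\<lambda>v \<in> verts G. at_vert E (v, 0)),
     at_arc = (\<lambda>e \<in> arcs G. at_arc E (e, 0) \<cdot> transition E (tail G e) 0 (p (Inr e)))\<rparr>"

definition collapse_functor where
  "collapse_functor = \<lparr>ObjMap = collapse_diagram,
     ArrMap = (\<lambda>T. \<lparr>mdom = collapse_diagram (mdom T), mcod = collapse_diagram (mcod T),
       component = (\<lambda>v \<in> verts G. component T (v, 0))\<rparr>)\<rparr>"

lemma spread_diagram_sel [simp]:
  "(v, n) \<in> verts H \<Longrightarrow> at_vert (spread_diagram D) (v, n) = at_vert D v"
  "(e, n) \<in> arcs H \<Longrightarrow> at_arc (spread_diagram D) (e, n) = at_arc D e"
  by (simp_all add: spread_diagram_def)

lemma collapse_diagram_sel [simp]: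
  "v \<in> verts G \<Longrightarrow> at_vert (collapse_diagram E) v = at_vert E (v, 0)"
  "e \<in> arcs G \<Longrightarrow> at_arc (collapse_diagram E) e
    = at_arc E (e, 0) \<cdot> transition E (tail G e) 0 (p (Inr e))"
  by (simp_all add: collapse_diagram_def)

text \<open>
  The coproduct demanded at a copy \<open>(v, n)\<close> is literally the one that the given diagram has at
  \<open>v\<close>, indexed by the arcs into \<open>v\<close>.
\<close>

lemma spread_diagram_in_Obj:
  assumes D: "D \<in> Obj \<D>"
  shows "spread_diagram D \<in> Obj \<D>'"
proof -
  have "at_vert (spread_diagram D) \<in> verts H \<rightarrow>\<^sub>E Obj C"
    using at_vert_in_Obj[OF D] by (auto simp: spread_diagram_def)
  moreover have "at_arc (spread_diagram D) x
      \<in> Hom C (at_vert (spread_diagram D) (tail H x)) (at_vert (spread_diagram D) (head H x))"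
    if "x \<in> arcs H" for x
    using that at_arc_in_Hom[OF D, of "fst x"] arc_bound by (cases x) simp
  moreover have "at_arc (spread_diagram D) \<in> extensional (arcs H)"
    by (simp add: spread_diagram_def)
  moreover have "coproduct_condition C H (spread_diagram D)"
    unfolding coproduct_condition_out_splitting
  proof (intro allI impI)
    fix v n assume v: "(v, n) \<in> verts H" "\<not> source_vertex G v"
    with D have "is_coproduct C (in_arcs G v) (\<lambda>e. at_vert D (tail G e)) (at_vert D v) (at_arc D)"
      by (simp add: coproduct_condition_def)
    moreover have "is_coproduct C (in_arcs G v) (\<lambda>e. at_vert (spread_diagram D) (tail G e, p (Inr e)))
        (at_vert (spread_diagram D) (v, n)) (\<lambda>e. at_arc (spread_diagram D) (e, n))
      \<longleftrightarrow> is_coproduct C (in_arcs G v) (\<lambda>e. at_vert D (tail G e))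
        (at_vert (spread_diagram D) (v, n)) (at_arc D)"
      using v arc_bound by (intro is_coproduct_cong) (auto simp: in_arcs_def)
    ultimately show "is_coproduct C (in_arcs G v)
        (\<lambda>e. at_vert (spread_diagram D) (tail G e, p (Inr e)))
        (at_vert (spread_diagram D) (v, n)) (\<lambda>e. at_arc (spread_diagram D) (e, n))"
      using v by simp
  qed
  ultimately show ?thesis by (simp add: diagrams_def PiE_def Pi_def del: split_paired_All)
qed

lemma cat_functor_spread: "cat_functor \<D> \<D>' spread_functor"
proof -
  interpret D: category \<D> by (rule category_coproduct_diagrams)
  interpret D': category \<D>' by (rule split.category_coproduct_diagrams)
  have arr: "ArrMap spread_functor T \<in> Hom \<D>' (ObjMap spread_functor D) (ObjMap spread_functor E)"
    if T: "T \<in> Hom \<D> D E" for T D E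
  proof -
    have D: "D \<in> Obj \<D>" and E: "E \<in> Obj \<D>" and dc: "mdom T = D" "mcod T = E"
      using T by (auto simp: Hom_coproduct_diagrams)
    have "component T (fst x) \<in> Hom C (at_vert (spread_diagram D) x) (at_vert (spread_diagram E) x)"
      if "x \<in> verts H" for x
      using that component_in_Hom[OF T] by (cases x) simp
    moreover have "component T (fst (head H x)) \<cdot> at_arc (spread_diagram D) x
        = at_arc (spread_diagram E) x \<cdot> component T (fst (tail H x))" if "x \<in> arcs H" for x
      using that component_square[OF T] by (cases x) simp
    ultimately show ?thesis
      using spread_diagram_in_Obj[OF D] spread_diagram_in_Obj[OF E] dc
      unfolding Hom_coproduct_diagrams by (simp add: spread_functor_def PiE_def Pi_def del: split_paired_All)
  qed
  show ?thesis
  proof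
    fix D assume D: "D \<in> Obj \<D>"
    show obj: "ObjMap spread_functor D \<in> Obj \<D>'"
      using spread_diagram_in_Obj[OF D] by (simp add: spread_functor_def)
    show "ArrMap spread_functor (Ident \<D> D) = Ident \<D>' (ObjMap spread_functor D)"
      by (rule diagram_morphism_eqI[OF arr[OF D.Ident_in_Hom[OF D]] D'.Ident_in_Hom[OF obj]])
        (auto simp: spread_functor_def)
  next
    fix S D E assume S: "S \<in> Hom \<D> D E"
    show "ArrMap spread_functor S \<in> Hom \<D>' (ObjMap spread_functor D) (ObjMap spread_functor E)"
      by (rule arr[OF S])
    fix T F assume T: "T \<in> Hom \<D> E F"
    show "ArrMap spread_functor (T \<cdot>\<^bsub>\<D>\<^esub> S) = ArrMap spread_functor T \<cdot>\<^bsub>\<D>'\<^esub> ArrMap spread_functor S"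
      by (rule diagram_morphism_eqI[OF arr[OF D.Comp_in_Hom[OF S T]] D'.Comp_in_Hom[OF arr[OF S] arr[OF T]]])
        (auto simp: spread_functor_def)
  qed
qed

lemma tail_copies: "e \<in> arcs G \<Longrightarrow> (tail G e, 0) \<in> verts H"
  "e \<in> arcs G \<Longrightarrow> (tail G e, p (Inr e)) \<in> verts H"
  using arc_bound by auto

lemma at_arc_copy_in_Hom:
  assumes "E \<in> Obj \<D>'" and "e \<in> arcs G" and "n \<le> p (Inl (head G e))"
  shows "at_arc E (e, n) \<in> Hom C (at_vert E (tail G e, p (Inr e))) (at_vert E (head G e, n))"
  using split.at_arc_in_Hom[OF assms(1), of "(e, n)"] assms by simp

lemma collapse_diagram_in_Obj:
  assumes E: "E \<in> Obj \<D>'"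
  shows "collapse_diagram E \<in> Obj \<D>"
proof -
  have "at_vert (collapse_diagram E) \<in> verts G \<rightarrow>\<^sub>E Obj C"
    using split.at_vert_in_Obj[OF E] by (auto simp: collapse_diagram_def)
  moreover have "at_arc (collapse_diagram E) e
      \<in> Hom C (at_vert (collapse_diagram E) (tail G e)) (at_vert (collapse_diagram E) (head G e))"
    if e: "e \<in> arcs G" for e
    using Comp_in_Hom[OF transition_in_Hom[OF E tail_copies[OF e]] at_arc_copy_in_Hom[OF E e]] e
    by simp
  moreover have "at_arc (collapse_diagram E) \<in> extensional (arcs G)"
    by (simp add: collapse_diagram_def)
  moreover have "coproduct_condition C G (collapse_diagram E)"
    unfolding coproduct_condition_def
  proof (intro ballI impI)
    fix v assume v: "v \<in> verts G" "\<not> source_vertex G v"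
    have "is_coproduct C (in_arcs G v) (\<lambda>e. at_vert E (tail G e, 0)) (at_vert E (v, 0))
      (\<lambda>e. at_arc E (e, 0) \<cdot> transition E (tail G e) 0 (p (Inr e)))"
      using v tail_copies
      by (intro is_coproduct_iso_summands[OF copy_coproduct[OF E]]
          transition_in_Hom[OF E] isomorphism_transition[OF E]) (simp_all add: in_arcs_def)
    moreover have "is_coproduct C (in_arcs G v) (\<lambda>e. at_vert (collapse_diagram E) (tail G e))
        (at_vert (collapse_diagram E) v) (at_arc (collapse_diagram E))
      \<longleftrightarrow> is_coproduct C (in_arcs G v) (\<lambda>e. at_vert E (tail G e, 0))
        (at_vert (collapse_diagram E) v)
        (\<lambda>e. at_arc E (e, 0) \<cdot> transition E (tail G e) 0 (p (Inr e)))"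
      by (intro is_coproduct_cong) (simp_all add: in_arcs_def)
    ultimately show "is_coproduct C (in_arcs G v) (\<lambda>e. at_vert (collapse_diagram E) (tail G e))
        (at_vert (collapse_diagram E) v) (at_arc (collapse_diagram E))"
      using v by simp
  qed
  ultimately show ?thesis by (simp add: diagrams_def PiE_def Pi_def del: split_paired_All)
qed

text \<open>
  The components at the copies \<open>0\<close> commute with the arrows of the collapsed diagrams since they
  commute with the arrows at the arcs \<open>(e, 0)\<close> and, by naturality, with the transitions.
\<close>

lemma cat_functor_collapse: "cat_functor \<D>' \<D> collapse_functor"
proof -
  interpret D: category \<D> by (rule category_coproduct_diagrams)
  interpret D': category \<D>' by (rule split.category_coproduct_diagrams)
  have arr: "ArrMap collapse_functor T \<in> Hom \<D> (ObjMap collapse_functor E) (ObjMap collapse_functor F)"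
    if T: "T \<in> Hom \<D>' E F" for T E F
  proof -
    have E: "E \<in> Obj \<D>'" and F: "F \<in> Obj \<D>'" and dc: "mdom T = E" "mcod T = F"
      using T by (auto simp: Hom_coproduct_diagrams)
    have "component T (v, 0) \<in> Hom C (at_vert E (v, 0)) (at_vert F (v, 0))" if "v \<in> verts G" for v
      using split.component_in_Hom[OF T] that by simp
    moreover have "component T (head G e, 0) \<cdot> at_arc (collapse_diagram E) e
        = at_arc (collapse_diagram F) e \<cdot> component T (tail G e, 0)" if e: "e \<in> arcs G" for e
    proof -
      let ?t = "tail G e" and ?q = "p (Inr e)"
      note t0 = tail_copies(1)[OF e] and tq = tail_copies(2)[OF e]
      have h0: "(head G e, 0) \<in> verts H" and e0: "(e, 0) \<in> arcs H" using e by auto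
      note cE = transition_in_Hom[OF E t0 tq] and cF = transition_in_Hom[OF F t0 tq]
        and aE = at_arc_copy_in_Hom[OF E e le0] and aF = at_arc_copy_in_Hom[OF F e le0]
        and T0 = split.component_in_Hom[OF T t0] and Tq = split.component_in_Hom[OF T tq]
        and Th = split.component_in_Hom[OF T h0]
      have "component T (head G e, 0) \<cdot> (at_arc E (e, 0) \<cdot> transition E ?t 0 ?q)
          = (at_arc F (e, 0) \<cdot> component T (?t, ?q)) \<cdot> transition E ?t 0 ?q"
        using Comp_assoc[OF cE aE Th] split.component_square[OF T e0] by simp
      also have "\<dots> = at_arc F (e, 0) \<cdot> (transition F ?t 0 ?q \<cdot> component T (?t, 0))"
        using Comp_assoc[OF cE Tq aF] transition_natural[OF T t0 tq] by simp
      also have "\<dots> = (at_arc F (e, 0) \<cdot> transition F ?t 0 ?q) \<cdot> component T (?t, 0)"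
        using Comp_assoc[OF T0 cF aF] by simp
      finally show ?thesis using e by simp
    qed
    ultimately show ?thesis
      using collapse_diagram_in_Obj[OF E] collapse_diagram_in_Obj[OF F] dc
      unfolding Hom_coproduct_diagrams by (simp add: collapse_functor_def PiE_def Pi_def)
  qed
  show ?thesis
  proof
    fix E assume E: "E \<in> Obj \<D>'"
    show obj: "ObjMap collapse_functor E \<in> Obj \<D>"
      using collapse_diagram_in_Obj[OF E] by (simp add: collapse_functor_def)
    show "ArrMap collapse_functor (Ident \<D>' E) = Ident \<D> (ObjMap collapse_functor E)"
      by (rule diagram_morphism_eqI[OF arr[OF D'.Ident_in_Hom[OF E]] D.Ident_in_Hom[OF obj]])
        (simp add: collapse_functor_def)
  next
    fix S E F assume S: "S \<in> Hom \<D>' E F"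
    show "ArrMap collapse_functor S \<in> Hom \<D> (ObjMap collapse_functor E) (ObjMap collapse_functor F)"
      by (rule arr[OF S])
    fix T K assume T: "T \<in> Hom \<D>' F K"
    show "ArrMap collapse_functor (T \<cdot>\<^bsub>\<D>'\<^esub> S)
        = ArrMap collapse_functor T \<cdot>\<^bsub>\<D>\<^esub> ArrMap collapse_functor S"
      by (rule diagram_morphism_eqI[OF arr[OF D'.Comp_in_Hom[OF S T]] D.Comp_in_Hom[OF arr[OF S] arr[OF T]]])
        (simp add: collapse_functor_def)
  qed
qed


section \<open>The equivalence\<close>

lemma transition_spread_diagram:
  assumes D: "D \<in> Obj \<D>" and m: "(v, m) \<in> verts H" and n: "(v, n) \<in> verts H"
  shows "transition (spread_diagram D) v m n = Ident C (at_vert D v)"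
proof (rule transition_eqI[OF spread_diagram_in_Obj[OF D] m n])
  have "Ident C (at_vert D v) \<cdot> at_arc D e = at_arc D e" if "e \<in> in_arcs G v" for e
    using at_arc_in_Hom[OF D, of e] that by (auto simp: in_arcs_def intro: Comp_Ident_left)
  then show "is_transition (spread_diagram D) v m n (Ident C (at_vert D v))"
    using Ident_in_Hom[OF at_vert_in_Obj[OF D]] m n by (auto simp: is_transition_def in_arcs_def)
qed

text \<open>
  Diagrams are extensional families, so this is an equality and not merely an isomorphism; the
  unit of the equivalence can therefore be taken to be the identity.
\<close>

lemma collapse_spread_diagram:
  assumes D: "D \<in> Obj \<D>"
  shows "collapse_diagram (spread_diagram D) = D"
proof (rule diagram_eqI[of _ C G])
  show "collapse_diagram (spread_diagram D) \<in> diagrams C G" "D \<in> diagrams C G"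
    using D collapse_diagram_in_Obj[OF spread_diagram_in_Obj[OF D]] by simp_all
  show "at_arc (collapse_diagram (spread_diagram D)) e = at_arc D e" if e: "e \<in> arcs G" for e
    using e transition_spread_diagram[OF D tail_copies[OF e]] Comp_Ident_right[OF at_arc_in_Hom[OF D e]]
    by simp
qed simp

lemma collapse_spread_iso_id:
  "natural_isomorphism \<D> \<D> id_functor (comp_functor collapse_functor spread_functor) (Ident \<D>)"
proof -
  interpret D: category \<D> by (rule category_coproduct_diagrams)
  interpret I: cat_functor \<D> \<D> id_functor by (rule cat_functor_id) (rule category_coproduct_diagrams)
  interpret GF: cat_functor \<D> \<D> "comp_functor collapse_functor spread_functor"
    by (rule cat_functor_comp[OF cat_functor_spread cat_functor_collapse])
  have obj: "ObjMap (comp_functor collapse_functor spread_functor) D = D" if "D \<in> Obj \<D>" for D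
    using collapse_spread_diagram[OF that]
    by (simp add: comp_functor_def collapse_functor_def spread_functor_def)
  have id: "ObjMap id_functor D = D" "ArrMap id_functor T = T" for D T
    by (simp_all add: id_functor_def)
  have arr: "ArrMap (comp_functor collapse_functor spread_functor) T = T" if T: "T \<in> Hom \<D> D E" for T D E
  proof (rule diagram_morphism_eqI[OF _ T])
    have "D \<in> Obj \<D>" "E \<in> Obj \<D>" using D.Hom_objects[OF T] by auto
    then show "ArrMap (comp_functor collapse_functor spread_functor) T \<in> Hom \<D> D E"
      using GF.ArrMap_in_Hom[OF T] by (simp only: obj)
    show "component (ArrMap (comp_functor collapse_functor spread_functor) T) v = component T v"
      if "v \<in> verts G" for v
      using that by (simp add: comp_functor_def collapse_functor_def spread_functor_def)
  qed
  show ?thesis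
  proof
    fix D assume D: "D \<in> Obj \<D>"
    show "Ident \<D> D \<in> Hom \<D> (ObjMap id_functor D)
        (ObjMap (comp_functor collapse_functor spread_functor) D)"
      unfolding obj[OF D] id by (rule D.Ident_in_Hom[OF D])
    show "isomorphism \<D> (Ident \<D> D)" by (rule D.isomorphism_Ident[OF D])
  next
    fix T D E assume T: "T \<in> Hom \<D> D E"
    show "Ident \<D> E \<cdot>\<^bsub>\<D>\<^esub> ArrMap id_functor T
        = ArrMap (comp_functor collapse_functor spread_functor) T \<cdot>\<^bsub>\<D>\<^esub> Ident \<D> D"
      unfolding arr[OF T] id D.Comp_Ident_right[OF T] by (rule D.Comp_Ident_left[OF T])
  qed
qed

definition counit where
  "counit E = \<lparr>mdom = spread_diagram (collapse_diagram E), mcod = E,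
     component = (\<lambda>x \<in> verts H. transition E (fst x) 0 (snd x))\<rparr>"

text \<open>
  For the square at an arc \<open>(e, n)\<close>, the transition at the head turns the arrow at \<open>(e, 0)\<close> into
  the one at \<open>(e, n)\<close>, and the transition that the collapsed diagram inserts at the tail is the
  component of the counit there.
\<close>

lemma counit_in_Hom:
  assumes E: "E \<in> Obj \<D>'"
  shows "counit E \<in> Hom \<D>' (spread_diagram (collapse_diagram E)) E"
proof -
  let ?E = "spread_diagram (collapse_diagram E)"
  have "transition E (fst x) 0 (snd x) \<in> Hom C (at_vert ?E x) (at_vert E x)" if "x \<in> verts H" for x
    using that transition_in_Hom[OF E] by (cases x) simp
  moreover have "component (counit E) (head H x) \<cdot> at_arc ?E x
      = at_arc E x \<cdot> component (counit E) (tail H x)" if x: "x \<in> arcs H" for x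
  proof -
    obtain e n where x': "x = (e, n)" by (cases x)
    with x have e: "e \<in> arcs G" and n: "n \<le> p (Inl (head G e))" by auto
    have h: "(head G e, 0) \<in> verts H" "(head G e, n) \<in> verts H" using e n by auto
    have "transition E (head G e) 0 n \<cdot> (at_arc E (e, 0) \<cdot> transition E (tail G e) 0 (p (Inr e)))
        = at_arc E (e, n) \<cdot> transition E (tail G e) 0 (p (Inr e))"
      using Comp_assoc[OF transition_in_Hom[OF E tail_copies[OF e]] at_arc_copy_in_Hom[OF E e le0]
          transition_in_Hom[OF E h]] transition_at_arc[OF E e le0 n] by simp
    then show ?thesis
      using e n tail_copies[OF e] by (simp add: x' counit_def)
  qed
  ultimately show ?thesis
    using E spread_diagram_in_Obj[OF collapse_diagram_in_Obj[OF E]]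
    unfolding Hom_coproduct_diagrams by (simp add: counit_def PiE_def Pi_def del: split_paired_All)
qed

lemma spread_collapse_iso_id:
  "natural_isomorphism \<D>' \<D>' (comp_functor spread_functor collapse_functor) id_functor counit"
proof -
  interpret D': category \<D>' by (rule split.category_coproduct_diagrams)
  interpret I: cat_functor \<D>' \<D>' id_functor by (rule cat_functor_id) (rule split.category_coproduct_diagrams)
  interpret FG: cat_functor \<D>' \<D>' "comp_functor spread_functor collapse_functor"
    by (rule cat_functor_comp[OF cat_functor_collapse cat_functor_spread])
  have obj: "ObjMap (comp_functor spread_functor collapse_functor) E
      = spread_diagram (collapse_diagram E)" for E
    by (simp add: comp_functor_def collapse_functor_def spread_functor_def)
  have id: "ObjMap id_functor E = E" "ArrMap id_functor T = T" for E T
    by (simp_all add: id_functor_def)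
  show ?thesis
  proof
    fix E assume E: "E \<in> Obj \<D>'"
    show "counit E \<in> Hom \<D>' (ObjMap (comp_functor spread_functor collapse_functor) E)
        (ObjMap id_functor E)"
      using counit_in_Hom[OF E] by (simp only: obj id)
    have "isomorphism C (component (counit E) x)" if "x \<in> verts H" for x
      using that isomorphism_transition[OF E] by (cases x) (simp add: counit_def)
    then show "isomorphism \<D>' (counit E)"
      by (rule split.isomorphism_of_diagrams[OF counit_in_Hom[OF E]])
  next
    fix T E F assume T: "T \<in> Hom \<D>' E F"
    then have E: "E \<in> Obj \<D>'" and F: "F \<in> Obj \<D>'" using D'.Hom_objects by blast+
    note FGT = FG.ArrMap_in_Hom[OF T, unfolded obj]
    show "counit F \<cdot>\<^bsub>\<D>'\<^esub> ArrMap (comp_functor spread_functor collapse_functor) T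
        = ArrMap id_functor T \<cdot>\<^bsub>\<D>'\<^esub> counit E"
      unfolding id
    proof (rule diagram_morphism_eqI[OF D'.Comp_in_Hom[OF FGT counit_in_Hom[OF F]]
          D'.Comp_in_Hom[OF counit_in_Hom[OF E] T]])
      fix x assume x: "x \<in> verts H"
      then show "component (counit F \<cdot>\<^bsub>\<D>'\<^esub> ArrMap (comp_functor spread_functor collapse_functor) T) x
          = component (T \<cdot>\<^bsub>\<D>'\<^esub> counit E) x"
        using transition_natural[OF T, of "fst x" 0 "snd x"]
        by (cases x) (simp add: counit_def comp_functor_def collapse_functor_def spread_functor_def)
    qed
  qed
qed

lemma equivalent_categories_out_splitting: "equivalent_categories \<D> \<D>'"
  unfolding equivalent_categories_def
  using cat_functor_spread cat_functor_collapse collapse_spread_iso_id spread_collapse_iso_id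
  by blast

end

theorem theorem4p34:
  fixes G :: "('v, 'e) pre_digraph"
    and p :: "'v + 'e \<Rightarrow> nat"
    and C :: "('o, 'm) category"
  assumes "wf_digraph G" and "verts G \<noteq> {}"
    and "\<And>e. e \<in> arcs G \<Longrightarrow> p (Inr e) \<le> p (Inl (tail G e))"
    and "\<And>v. v \<in> verts G \<Longrightarrow> source_vertex G v \<Longrightarrow> p (Inl v) = 0"
    and "category C"
  shows "equivalent_categories (coproduct_diagrams C G) (coproduct_diagrams C (out_splitting G p))"
proof -
  interpret out_split C G p
    using assms by (intro out_split.intro shaped_diagrams.intro out_split_axioms.intro)
      (auto simp: source_vertex_def)
  show ?thesis by (rule equivalent_categories_out_splitting)
qed

end
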